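(* Let $A,B\subset\mathbb{R}^m$ be closed sets in the smooth transverse setting (see context) and let $x^*\in A\cap B$ be the transversal intersection point. Let $p_A,p_B$ be the orthogonal projectors onto the tangent spaces $T_{x^*}A$ and $T_{x^*}B$. Then $x^*$ is an equilibrium of the flow $\dot x=v(x)$, and the Jacobian of $v$ at $x^*$ is $$Dv(x^* ) = DP_B(x^* )\,DR_A(x^* )-DP_A(x^* ) = 2p_Bp_A-p_B-p_A .$$ Moreover: (i) On the intersection $T_{x^*}A\cap T_{x^*}B$ one has $Dv(x^* )=0$. (ii) On each principal-angle $2$-plane of the pair $(T_{x^*}A,T_{x^*}B)$ with angle $\theta\in(0,\frac{\pi}{2}]$ there exists an orthonormal basis in which $$p_A=\begin{bmatrix}1&0\\0&0\end{bmatrix},\qquad p_B=\begin{bmatrix}\cos^2\theta&\cos\theta\sin\theta\\ \cos\theta\sin\theta&\sin^2\theta\end{bmatrix},$$ and in this basis the restriction of $Dv(x^* )$ is $$r(\theta)=\begin{bmatrix}-\sin^2\theta&-\sin\theta\cos\theta\\ \sin\theta\cos\theta&-\sin^2\theta\end{bmatrix}.$$ The eigenvalues of $r(\theta)$ are $-\sin^2\theta\pm i\sin\theta\cos\theta$, and its symmetric part equals $-\sin^2\theta\, I_2$.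
   Context: For closed sets $A,B\subset\mathbb{R}^m$ let $P_A,P_B$ be the metric (nearest-point) projections, $R_A:=2P_A-\mathrm{Id}$ the reflector, and $v(x):=P_B(R_Ax)-P_Ax$ the Reflect-Reflect-Relax (RRR) flow field. Smooth transverse setting: $A$ and $B$ are $C^2$ embedded submanifolds of $\mathbb{R}^m$ that intersect transversally at $x^*\in A\cap B$. In a sufficiently small neighborhood of $x^*$ the projections $P_A$ and $P_B$ are single-valued and $C^1$, and their derivatives at $x^*$ are the orthogonal projectors $p_A,p_B$ onto $T_{x^*}A$, $T_{x^*}B$. The intersection $M:=A\cap B$ is then a $C^2$ submanifold, and $P_A,P_B$ restrict to the identity on $M$ near $x^*$. Principal-angle planes: the sum $T_{x^*}A+T_{x^*}B$ has an orthogonal decomposition into the common tangent subspace $T_{x^*}A\cap T_{x^*}B$ and principal-angle planes; a principal-angle $2$-plane is invariant under $p_A$ and $p_B$, meets each of $T_{x^*}A$ and $T_{x^*}B$ in a line, and the angle between these two lines is the principal angle $\theta\in(0,\frac{\pi}{2}]$. *)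

theory Defs
  imports "HOL-Analysis.Analysis"
begin

text \<open>
  The metric projection onto a closed nonempty set is the library's \<^const>\<open>closest_point\<close>.
  It is a total function: where the nearest point is not unique, it makes an arbitrary choice
  among the nearest points.
\<close>

definition reflector :: "'a::euclidean_space set \<Rightarrow> 'a \<Rightarrow> 'a" where
  "reflector A x = 2 *\<^sub>R closest_point A x - x"

definition rrr_field :: "'a::euclidean_space set \<Rightarrow> 'a set \<Rightarrow> 'a \<Rightarrow> 'a" where
  "rrr_field A B x = closest_point B (reflector A x) - closest_point A x"


subsection \<open>Submanifolds of class C2\<close>

definition C2_on :: "('a::euclidean_space \<Rightarrow> 'b::euclidean_space) \<Rightarrow> 'a set \<Rightarrow> bool" where
  "C2_on f U \<longleftrightarrow>
    (\<exists>(f' :: 'a \<Rightarrow> 'a \<Rightarrow>\<^sub>L 'b) (f'' :: 'a \<Rightarrow> 'a \<Rightarrow>\<^sub>L 'a \<Rightarrow>\<^sub>L 'b).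
      (\<forall>x\<in>U. (f has_derivative blinfun_apply (f' x)) (at x)) \<and>
      (\<forall>x\<in>U. (f' has_derivative blinfun_apply (f'' x)) (at x)) \<and>
      continuous_on U f'')"

text \<open>
  Slice charts: near each of its points, \<open>M\<close> is straightened by an ambient diffeomorphism onto an
  open piece of a \<open>d\<close>-dimensional linear subspace \<open>L\<close> (an arbitrary \<open>L\<close> instead of a
  coordinate subspace, from which it differs by a linear isomorphism).
\<close>

definition embedded_C2_submanifold :: "nat \<Rightarrow> 'a::euclidean_space set \<Rightarrow> bool" where
  "embedded_C2_submanifold d M \<longleftrightarrow>
    (\<forall>p\<in>M. \<exists>U V \<phi> \<psi> (L :: 'a set).
      open U \<and> p \<in> U \<and> open V \<and> homeomorphism U V \<phi> \<psi> \<and> C2_on \<phi> U \<and> C2_on \<psi> V \<and>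
      subspace L \<and> dim L = d \<and> \<phi> ` (M \<inter> U) = L \<inter> V)"

text \<open>Velocities at \<open>p\<close> of the C1 curves in \<open>M\<close> through \<open>p\<close>.\<close>

definition tangent_space :: "'a::euclidean_space set \<Rightarrow> 'a \<Rightarrow> 'a set" where
  "tangent_space M p =
    {w. \<exists>(\<gamma> :: real \<Rightarrow> 'a) \<epsilon>. \<epsilon> > 0 \<and> \<gamma> C1_differentiable_on {-\<epsilon><..<\<epsilon>} \<and>
          \<gamma> ` {-\<epsilon><..<\<epsilon>} \<subseteq> M \<and> \<gamma> 0 = p \<and> (\<gamma> has_vector_derivative w) (at 0)}"

definition transversal_at :: "'a::euclidean_space set \<Rightarrow> 'a set \<Rightarrow> 'a \<Rightarrow> bool" where
  "transversal_at A B x \<longleftrightarrow>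
    x \<in> A \<inter> B \<and> {a + b | a b. a \<in> tangent_space A x \<and> b \<in> tangent_space B x} = UNIV"


subsection \<open>Orthogonal projectors and principal-angle planes\<close>

text \<open>Well defined (unique existence) when \<open>S\<close> is a linear subspace.\<close>

definition orth_projector :: "'a::euclidean_space set \<Rightarrow> 'a \<Rightarrow> 'a" where
  "orth_projector S x = (THE y. y \<in> S \<and> (\<forall>s\<in>S. orthogonal (x - y) s))"

text \<open>The angle between two lines through the origin lies in \<open>[0, \<pi>/2]\<close>.\<close>

definition is_line_angle :: "'a::euclidean_space set \<Rightarrow> 'a set \<Rightarrow> real \<Rightarrow> bool" where
  "is_line_angle L K \<theta> \<longleftrightarrow>
    0 \<le> \<theta> \<and> \<theta> \<le> pi / 2 \<and> (\<forall>a\<in>L. \<forall>b\<in>K. \<bar>a \<bullet> b\<bar> = cos \<theta> * norm a * norm b)"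

definition principal_angle_plane ::
    "'a::euclidean_space set \<Rightarrow> 'a set \<Rightarrow> 'a set \<Rightarrow> real \<Rightarrow> bool" where
  "principal_angle_plane S T W \<theta> \<longleftrightarrow>
    subspace W \<and> dim W = 2 \<and>
    orth_projector S ` W \<subseteq> W \<and> orth_projector T ` W \<subseteq> W \<and>
    dim (W \<inter> S) = 1 \<and> dim (W \<inter> T) = 1 \<and>
    is_line_angle (W \<inter> S) (W \<inter> T) \<theta> \<and> \<theta> \<in> {0<..pi / 2}"


subsection \<open>Matrices of restricted maps\<close>

definition orthonormal_basis_of :: "('n::finite \<Rightarrow> 'a::euclidean_space) \<Rightarrow> 'a set \<Rightarrow> bool" where
  "orthonormal_basis_of e W \<longleftrightarrow>
    (\<forall>i j. e i \<bullet> e j = (if i = j then 1 else 0)) \<and> span (range e) = W"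

text \<open>
  For a basis \<open>e\<close> of a subspace \<open>W\<close> and a linear map \<open>f\<close>, this says that \<open>W\<close> is invariant under
  \<open>f\<close> and that \<open>N\<close> is the matrix of the restriction of \<open>f\<close> to \<open>W\<close> (columns are images of the
  basis vectors).
\<close>

definition has_matrix_in :: "('a::euclidean_space \<Rightarrow> 'a) \<Rightarrow> ('n::finite \<Rightarrow> 'a) \<Rightarrow> real^'n^'n \<Rightarrow> bool" where
  "has_matrix_in f e N \<longleftrightarrow> (\<forall>j. f (e j) = (\<Sum>i\<in>UNIV. N $ i $ j *\<^sub>R e i))"

definition rrr_block :: "real \<Rightarrow> real^2^2" where
  "rrr_block \<theta> = vector [vector [- (sin \<theta>)\<^sup>2, - (sin \<theta> * cos \<theta>)],
                          vector [sin \<theta> * cos \<theta>, - (sin \<theta>)\<^sup>2]]"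

definition complex_matrix :: "real^'n^'m \<Rightarrow> complex^'n^'m" where
  "complex_matrix N = (\<chi> i j. complex_of_real (N $ i $ j))"

definition eigenvalues :: "real^'n^'n \<Rightarrow> complex set" where
  "eigenvalues N = {z. \<exists>w. w \<noteq> 0 \<and> complex_matrix N *v w = z *s w}"

definition symmetric_part :: "real^'n^'n \<Rightarrow> real^'n^'n" where
  "symmetric_part N = (1 / 2) *\<^sub>R (N + transpose N)"

end

theory Submission
  imports Defs
begin

text \<open>
  A nearest-point projection is differentiable at a point \<open>p\<close> of \<open>M\<close> as soon as \<open>M\<close> is
  approximated to first order at \<open>p\<close> by a subspace \<open>T\<close>, in both directions. If \<open>y\<close> is nearest to
  \<open>p + h\<close>, \<open>s\<close> is the element of \<open>T\<close> approximating \<open>y - p\<close> and \<open>t\<close> is the projection of \<open>h\<close> to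
  \<open>T\<close>, then minimality gives \<open>|h - s| \<le> |h - t| + o(|h|)\<close>, and Pythagoras turns this into
  \<open>|s - t|\<^sup>2 = o(|h|\<^sup>2)\<close>. Slice charts provide the approximation with the tangent space as \<open>T\<close>.
  The Jacobian of the flow field then follows from the chain rule, and its blocks from a computation
  in a basis adapted to the two lines of a principal-angle plane.
\<close>

section \<open>Orthogonal projectors onto subspaces\<close>

text \<open>Two candidates differ by an element of \<open>S\<close> that is orthogonal to itself.
  This discharges the description operator in \<open>orth_projector\<close>; later facts only verify
  the characterization.\<close>

lemma orth_projector_unique:
  assumes "subspace S" "y \<in> S" "\<And>s. s \<in> S \<Longrightarrow> orthogonal (x - y) s"
  shows "orth_projector S x = y"
  unfolding orth_projector_def
proof (rule the_equality)
  show "y \<in> S \<and> (\<forall>s\<in>S. orthogonal (x - y) s)"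
    using assms by blast
next
  fix z assume z: "z \<in> S \<and> (\<forall>s\<in>S. orthogonal (x - z) s)"
  then have "z - y \<in> S"
    using assms by (simp add: subspace_diff)
  then have "(x - z) \<bullet> (z - y) = 0" "(x - y) \<bullet> (z - y) = 0"
    using z assms(3) by (auto simp: orthogonal_def)
  then have "(z - y) \<bullet> (z - y) = 0"
    by (simp add: inner_diff_left)
  then show "z = y"
    by simp
qed

lemma
  assumes "subspace S"
  shows orth_projector_mem: "orth_projector S x \<in> S"
    and orth_projector_orthogonal: "s \<in> S \<Longrightarrow> (x - orth_projector S x) \<bullet> s = 0"
proof -
  obtain y z where yz: "y \<in> span S" "\<And>w. w \<in> span S \<Longrightarrow> orthogonal z w" "x = y + z"
    using orthogonal_subspace_decomp_exists[of S x] by blast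
  moreover have "span S = S"
    using assms by (simp add: span_eq_iff)
  ultimately have "orth_projector S x = y"
    by (intro orth_projector_unique assms) auto
  then show "orth_projector S x \<in> S" "s \<in> S \<Longrightarrow> (x - orth_projector S x) \<bullet> s = 0"
    using yz \<open>span S = S\<close> by (auto simp: orthogonal_def)
qed

lemma orth_projector_id:
  "subspace S \<Longrightarrow> x \<in> S \<Longrightarrow> orth_projector S x = x"
  by (rule orth_projector_unique) (auto simp: orthogonal_def)

text \<open>The sum and the scalar multiple of projections satisfy the characterization for the sum
  and the scalar multiple of the arguments, so uniqueness gives linearity.\<close>

lemma linear_orth_projector:
  assumes S: "subspace S"
  shows "linear (orth_projector S)"
proof (rule linearI)
  note mem = orth_projector_mem[OF S] and orth = orth_projector_orthogonal[OF S]
  show "orth_projector S (x + y) = orth_projector S x + orth_projector S y" for x y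
  proof (rule orth_projector_unique[OF S])
    show "orthogonal (x + y - (orth_projector S x + orth_projector S y)) s" if "s \<in> S" for s
      using orth[OF that, of x] orth[OF that, of y]
      by (simp add: orthogonal_def inner_diff_left inner_add_left)
  qed (simp add: S mem subspace_add)
  show "orth_projector S (c *\<^sub>R x) = c *\<^sub>R orth_projector S x" for c x
  proof (rule orth_projector_unique[OF S])
    show "orthogonal (c *\<^sub>R x - c *\<^sub>R orth_projector S x) s" if "s \<in> S" for s
      using orth[OF that, of x] by (simp add: orthogonal_def inner_diff_left)
  qed (simp add: S mem subspace_scale)
qed

lemma norm_diff_orth_projector:
  assumes "subspace S" "s \<in> S"
  shows "(norm (x - s))\<^sup>2 = (norm (x - orth_projector S x))\<^sup>2 + (norm (orth_projector S x - s))\<^sup>2"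
proof -
  have "orthogonal (x - orth_projector S x) (orth_projector S x - s)"
    using assms by (simp add: orthogonal_def orth_projector_orthogonal orth_projector_mem subspace_diff)
  from norm_add_Pythagorean[OF this] show ?thesis
    by simp
qed

lemma norm_orth_projector_le:
  assumes "subspace S"
  shows "norm (orth_projector S x) \<le> norm x" "norm (x - orth_projector S x) \<le> norm x"
proof -
  have "(norm x)\<^sup>2 = (norm (x - orth_projector S x))\<^sup>2 + (norm (orth_projector S x))\<^sup>2"
    using norm_diff_orth_projector[OF assms subspace_0[OF assms], of x] by simp
  then show "norm (orth_projector S x) \<le> norm x" "norm (x - orth_projector S x) \<le> norm x"
    by (simp_all add: power2_le_imp_le)
qed

section \<open>Differentiability of the nearest-point projection\<close>

text \<open>The two approximation hypotheses have different roles: \<open>M_approx\<close> moves the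
  nearest point into \<open>T\<close> at small cost, while \<open>T_approx\<close> supplies a
  competitor in \<open>M\<close> close to the projection onto \<open>T\<close>. The estimate holds
  for whichever nearest point \<open>closest_point\<close> selects.\<close>

lemma closest_point_has_derivative_orth_projector:
  fixes M T :: "'a::euclidean_space set"
  assumes M: "closed M" "p \<in> M" and T: "subspace T"
    and M_approx: "\<And>e. e > 0 \<Longrightarrow>
      \<exists>d>0. \<forall>y\<in>M. norm (y - p) < d \<longrightarrow> (\<exists>s\<in>T. norm (y - p - s) \<le> e * norm (y - p))"
    and T_approx: "\<And>e. e > 0 \<Longrightarrow>
      \<exists>d>0. \<forall>t\<in>T. norm t < d \<longrightarrow> (\<exists>y\<in>M. norm (y - p - t) \<le> e * norm t)"
  shows "(closest_point M has_derivative orth_projector T) (at p)"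
  unfolding has_derivative_within_alt
proof (intro conjI allI impI)
  show "bounded_linear (orth_projector T)"
    by (simp add: T linear_conv_bounded_linear[symmetric] linear_orth_projector)
  fix e :: real
  assume e: "e > 0"
  \<comment> \<open>The bound below is \<open>norm (t - s)\<^sup>2 \<le> (6 * k + 9 * k\<^sup>2) * (norm h)\<^sup>2\<close>.\<close>
  define k where "k = min (e / 4) (min 1 (e\<^sup>2 / 60))"
  have k: "k > 0" "k \<le> 1" "k \<le> e / 4" "k \<le> e\<^sup>2 / 60"
    using e by (auto simp: k_def)
  from M_approx[OF k(1)] obtain d1 where d1: "d1 > 0"
    "\<And>y. y \<in> M \<Longrightarrow> norm (y - p) < d1 \<Longrightarrow> \<exists>s\<in>T. norm (y - p - s) \<le> k * norm (y - p)"
    by blast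
  from T_approx[OF k(1)] obtain d2 where d2: "d2 > 0"
    "\<And>t. t \<in> T \<Longrightarrow> norm t < d2 \<Longrightarrow> \<exists>y\<in>M. norm (y - p - t) \<le> k * norm t"
    by blast
  show "\<exists>d>0. \<forall>x\<in>UNIV. norm (x - p) < d \<longrightarrow>
      norm (closest_point M x - closest_point M p - orth_projector T (x - p)) \<le> e * norm (x - p)"
  \<comment> \<open>The radius is \<open>d1 / 2\<close> because the nearest point may lie twice as
    far from \<open>p\<close> as \<open>x\<close> does.\<close>
  proof (intro exI[of _ "min (d1 / 2) d2"] conjI ballI impI)
    show "min (d1 / 2) d2 > 0"
      using d1(1) d2(1) by simp
    fix x assume x: "norm (x - p) < min (d1 / 2) d2"
    define h t y where "h = x - p" and "t = orth_projector T h" and "y = closest_point M x"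
    have y: "y \<in> M" "\<And>z. z \<in> M \<Longrightarrow> norm (x - y) \<le> norm (x - z)"
      using closest_point_exists[OF M(1), of x] M(2) by (auto simp: y_def dist_norm)
    have t: "t \<in> T" "norm t \<le> norm h" "norm (h - t) \<le> norm h"
      using T by (simp_all add: t_def orth_projector_mem norm_orth_projector_le)
    have "norm (y - p) \<le> norm (x - p) + norm (x - y)"
      using norm_triangle_ineq4[of "x - p" "x - y"] by simp
    with y(2)[OF M(2)] have yp: "norm (y - p) \<le> 2 * norm h"
      by (simp add: h_def)
    with x d1(2)[OF y(1)] obtain s where s: "s \<in> T" "norm (y - p - s) \<le> k * norm (y - p)"
      by (auto simp: h_def)
    have ys: "norm (y - p - s) \<le> 2 * k * norm h"
      using order_trans[OF s(2) mult_left_mono[OF yp]] k(1) by (simp add: mult.assoc mult.left_commute)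
    \<comment> \<open>\<open>z\<close> is the competitor: a point of \<open>M\<close> close to
      \<open>p + t\<close>, against which the minimality of \<open>y\<close> is tested.\<close>
    from x t d2(2)[of t] obtain z where z: "z \<in> M" "norm (z - p - t) \<le> k * norm t"
      by (auto simp: h_def)
    have zt: "norm (z - p - t) \<le> k * norm h"
      using order_trans[OF z(2) mult_left_mono[OF t(2)]] k(1) by simp
    \<comment> \<open>Minimality passes from \<open>M\<close> to \<open>T\<close>: replacing
      \<open>y\<close> by \<open>p + s\<close> costs \<open>2 * k * norm h\<close>, and replacing
      \<open>z\<close> by \<open>p + t\<close> costs \<open>k * norm h\<close>.\<close>
    have "norm (h - s) \<le> norm (x - y) + norm (y - p - s)"
      using norm_triangle_ineq[of "x - y" "y - p - s"] by (simp add: h_def algebra_simps)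
    moreover have "norm (x - z) \<le> norm (h - t) + norm (z - p - t)"
      using norm_triangle_ineq4[of "h - t" "z - p - t"] by (simp add: h_def algebra_simps)
    ultimately have hs: "norm (h - s) \<le> norm (h - t) + 3 * k * norm h"
      using y(2)[OF z(1)] ys zt by linarith
    \<comment> \<open>By Pythagoras the left side is \<open>(norm (h - s))\<^sup>2\<close>.
      Expanding the right side cancels \<open>(norm (h - t))\<^sup>2\<close> and leaves only terms
      with a factor \<open>k\<close>.\<close>
    have "(norm (h - t))\<^sup>2 + (norm (t - s))\<^sup>2 \<le> (norm (h - t) + 3 * k * norm h)\<^sup>2"
      using power_mono[OF hs, of 2] norm_diff_orth_projector[OF T s(1), of h] by (simp add: t_def)
    then have "(norm (t - s))\<^sup>2 \<le> 6 * k * (norm (h - t) * norm h) + 9 * k * (k * (norm h)\<^sup>2)"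
      by (simp add: power2_eq_square algebra_simps)
    also have "\<dots> \<le> 6 * k * (norm h * norm h) + 9 * k * (1 * (norm h)\<^sup>2)"
      using k t(3) by (intro add_mono mult_left_mono mult_right_mono) auto
    also have "\<dots> = 15 * k * (norm h)\<^sup>2"
      by (simp add: power2_eq_square)
    also have "\<dots> \<le> 15 * (e\<^sup>2 / 60) * (norm h)\<^sup>2"
      using k by (intro mult_left_mono mult_right_mono) auto
    also have "\<dots> = (e / 2 * norm h)\<^sup>2"
      by (simp add: power2_eq_square)
    finally have "norm (t - s) \<le> e / 2 * norm h"
      by (rule power2_le_imp_le) (use e in simp)
    moreover have "2 * k * norm h \<le> e / 2 * norm h"
      using k by (intro mult_right_mono) auto
    moreover have "norm (y - p - t) \<le> norm (y - p - s) + norm (t - s)"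
      using norm_triangle_ineq4[of "y - p - s" "t - s"] by simp
    ultimately have "norm (y - p - t) \<le> e * norm h"
      using ys by linarith
    then show "norm (closest_point M x - closest_point M p - orth_projector T (x - p)) \<le> e * norm (x - p)"
      using M(2) by (simp add: y_def t_def h_def closest_point_self)
  qed
qed

section \<open>Tangent spaces in slice charts\<close>

text \<open>The chart turns curves in \<open>M\<close> into curves in \<open>L\<close>, whose
  velocities stay in \<open>L\<close> because \<open>L\<close> is closed; conversely,
  \<open>\<psi>\<close> carries straight segments in \<open>L\<close> to curves in \<open>M\<close>.
  The chain rule for the two compositions of \<open>\<phi>\<close> and \<open>\<psi>\<close> makes
  their derivatives mutually inverse.\<close>

lemma tangent_space_slice_chart:
  fixes M :: "'a::euclidean_space set"
  assumes U: "open U" "p \<in> U" and V: "open V" and hom: "homeomorphism U V \<phi> \<psi>"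
    and \<phi>: "(\<phi> has_derivative \<phi>') (at p)"
    and \<psi>: "\<And>x. x \<in> V \<Longrightarrow> (\<psi> has_derivative blinfun_apply (\<psi>' x)) (at x)" "continuous_on V \<psi>'"
    and p: "p \<in> M" and L: "subspace L" "\<phi> ` (M \<inter> U) = L \<inter> V"
  shows "tangent_space M p = \<psi>' (\<phi> p) ` L"
    and "\<phi>' (\<psi>' (\<phi> p) x) = x" and "\<psi>' (\<phi> p) (\<phi>' x) = x"
proof -
  note homD = homeomorphism_apply1[OF hom] homeomorphism_apply2[OF hom]
    homeomorphism_image1[OF hom] homeomorphism_image2[OF hom]
  have q: "\<phi> p \<in> L" "\<phi> p \<in> V"
    using L U p by blast+
  have \<psi>p: "\<psi> (\<phi> p) = p"
    using homD U by simp
  have "((\<lambda>x. \<psi> (\<phi> x)) has_derivative (\<lambda>x. \<psi>' (\<phi> p) (\<phi>' x))) (at p)"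
    by (rule has_derivative_compose[OF \<phi> \<psi>(1)[OF q(2)]])
  moreover have "((\<lambda>x. \<psi> (\<phi> x)) has_derivative (\<lambda>x. x)) (at p)"
    by (rule has_derivative_transform_within_open[OF has_derivative_ident U])
      (simp add: homD)
  ultimately have "(\<lambda>x. \<psi>' (\<phi> p) (\<phi>' x)) = (\<lambda>x. x)"
    by (rule has_derivative_unique)
  then show \<psi>\<phi>: "\<psi>' (\<phi> p) (\<phi>' x) = x" for x
    by meson
  have "((\<lambda>x. \<phi> (\<psi> x)) has_derivative (\<lambda>x. \<phi>' (\<psi>' (\<phi> p) x))) (at (\<phi> p))"
    by (rule has_derivative_compose[OF \<psi>(1)[OF q(2)]]) (simp add: \<psi>p \<phi>)
  moreover have "((\<lambda>x. \<phi> (\<psi> x)) has_derivative (\<lambda>x. x)) (at (\<phi> p))"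
    by (rule has_derivative_transform_within_open[OF has_derivative_ident V q(2)])
      (simp add: homD)
  ultimately have "(\<lambda>x. \<phi>' (\<psi>' (\<phi> p) x)) = (\<lambda>x. x)"
    by (rule has_derivative_unique)
  then show "\<phi>' (\<psi>' (\<phi> p) x) = x" for x
    by meson
  show "tangent_space M p = \<psi>' (\<phi> p) ` L"
  proof (intro equalityI subsetI)
    fix w assume "w \<in> tangent_space M p"
    then obtain \<gamma> \<epsilon> where \<gamma>: "\<epsilon> > 0" "\<gamma> ` {-\<epsilon><..<\<epsilon>} \<subseteq> M" "\<gamma> 0 = p"
      "(\<gamma> has_vector_derivative w) (at (0::real))"
      by (auto simp: tangent_space_def)
    have "(\<gamma> \<longlongrightarrow> p) (at 0)"
      using has_vector_derivative_continuous[OF \<gamma>(4)] \<gamma>(3) by (simp add: isCont_def)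
    then have "\<forall>\<^sub>F t in at 0. \<gamma> t \<in> U"
      using U by (rule topological_tendstoD)
    moreover have "\<forall>\<^sub>F t in at 0. t \<in> {-\<epsilon><..<\<epsilon>}"
      using \<gamma>(1) by (intro eventually_at_in_open') auto
    ultimately have ev: "\<forall>\<^sub>F t in at 0. (\<phi> (\<gamma> t) - \<phi> p) /\<^sub>R t \<in> L"
    proof eventually_elim
      case (elim t)
      then have "\<phi> (\<gamma> t) \<in> L"
        using \<gamma>(2) L(2) by blast
      with q(1) show ?case
        using L(1) by (intro subspace_scale subspace_diff)
    qed
    have "((\<lambda>t. \<phi> (\<gamma> t)) has_derivative (\<lambda>t. \<phi>' (t *\<^sub>R w))) (at 0)"
      using \<gamma>(3,4) \<phi> has_derivative_compose[of \<gamma> "\<lambda>t. t *\<^sub>R w" 0 UNIV \<phi> \<phi>']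
      by (simp add: has_vector_derivative_def)
    moreover have "\<phi>' (t *\<^sub>R w) = t *\<^sub>R \<phi>' w" for t
      by (simp add: linear_scale[OF has_derivative_linear[OF \<phi>]])
    ultimately have "((\<lambda>t. norm (\<phi> (\<gamma> t) - \<phi> p - t *\<^sub>R \<phi>' w) / norm t) \<longlongrightarrow> 0) (at 0)"
      using \<gamma>(3) by (simp add: has_derivative_at)
    \<comment> \<open>The remainder estimate is rewritten as convergence of difference quotients,
      which lie in \<open>L\<close> by \<open>ev\<close>. The two forms agree for
      \<open>t \<noteq> 0\<close>, which suffices for a limit at \<open>0\<close>.\<close>
    then have "((\<lambda>t. norm ((\<phi> (\<gamma> t) - \<phi> p) /\<^sub>R t - \<phi>' w)) \<longlongrightarrow> 0) (at 0)"
    proof (rule Lim_transform_eventually)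
      have "norm (\<phi> (\<gamma> t) - \<phi> p - t *\<^sub>R \<phi>' w) / norm t = norm ((\<phi> (\<gamma> t) - \<phi> p) /\<^sub>R t - \<phi>' w)"
        if "t \<noteq> 0" for t
      proof -
        have "(\<phi> (\<gamma> t) - \<phi> p) /\<^sub>R t - \<phi>' w = (\<phi> (\<gamma> t) - \<phi> p - t *\<^sub>R \<phi>' w) /\<^sub>R t"
          using that by (simp add: scaleR_diff_right)
        then show ?thesis
          by (simp add: divide_inverse mult.commute)
      qed
      then show "\<forall>\<^sub>F t in at 0. norm (\<phi> (\<gamma> t) - \<phi> p - t *\<^sub>R \<phi>' w) / norm t
          = norm ((\<phi> (\<gamma> t) - \<phi> p) /\<^sub>R t - \<phi>' w)"
        by (auto simp: eventually_at_filter)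
    qed
    then have "((\<lambda>t. (\<phi> (\<gamma> t) - \<phi> p) /\<^sub>R t) \<longlongrightarrow> \<phi>' w) (at 0)"
      by (simp only: tendsto_norm_zero_iff LIM_zero_iff)
    then have "\<phi>' w \<in> L"
      by (rule Lim_in_closed_set[OF closed_subspace[OF L(1)] ev trivial_limit_at])
    then show "w \<in> \<psi>' (\<phi> p) ` L"
      using \<psi>\<phi>[of w] by (metis image_eqI)
  next
    fix w assume "w \<in> \<psi>' (\<phi> p) ` L"
    then obtain l where l: "l \<in> L" "w = \<psi>' (\<phi> p) l"
      by blast
    \<comment> \<open>The line in \<open>L\<close> through \<open>\<phi> p\<close> with velocity
      \<open>l\<close>; for small \<open>t\<close> it stays in \<open>V\<close>, and its image under
      \<open>\<psi>\<close> is the required curve.\<close>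
    define c where "c t = \<phi> p + t *\<^sub>R l" for t :: real
    have c: "continuous_on UNIV c" "(c has_vector_derivative l) (at t)" "c t \<in> L" for t
      unfolding c_def using L(1) l(1) q(1)
      by (auto intro!: continuous_intros derivative_eq_intros subspace_add subspace_scale)
    have "open (c -` V)"
      using c(1) V by (rule open_vimage[rotated])
    moreover have "0 \<in> c -` V"
      using q by (simp add: c_def)
    ultimately obtain \<epsilon> where \<epsilon>: "\<epsilon> > 0" "ball 0 \<epsilon> \<subseteq> c -` V"
      using open_contains_ball by metis
    have cV: "c t \<in> V" if "t \<in> {-\<epsilon><..<\<epsilon>}" for t
      using subsetD[OF \<epsilon>(2), of t] that by (auto simp: abs_less_iff)
    have deriv: "((\<lambda>t. \<psi> (c t)) has_vector_derivative \<psi>' (c t) l) (at t)"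
      if "t \<in> {-\<epsilon><..<\<epsilon>}" for t
    proof -
      have "((\<lambda>t. \<psi> (c t)) has_derivative (\<lambda>x. \<psi>' (c t) (x *\<^sub>R l))) (at t)"
        using c(2) \<psi>(1)[OF cV[OF that]]
          has_derivative_compose[of c "\<lambda>x. x *\<^sub>R l" t UNIV \<psi> "\<psi>' (c t)"]
        by (simp add: has_vector_derivative_def)
      then show ?thesis
        by (simp add: has_vector_derivative_def blinfun.scaleR_right)
    qed
    show "w \<in> tangent_space M p"
      unfolding tangent_space_def
    proof (intro CollectI exI conjI)
      show "\<epsilon> > 0"
        by fact
      show "(\<lambda>t. \<psi> (c t)) C1_differentiable_on {-\<epsilon><..<\<epsilon>}"
        unfolding C1_differentiable_on_def
      proof (intro exI conjI ballI)
        show "continuous_on {-\<epsilon><..<\<epsilon>} (\<lambda>t. \<psi>' (c t) l)"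
          using cV by (intro continuous_intros continuous_on_compose2[OF \<psi>(2)]
              continuous_on_subset[OF c(1)]) auto
      qed (rule deriv)
      show "(\<lambda>t. \<psi> (c t)) ` {-\<epsilon><..<\<epsilon>} \<subseteq> M"
      proof clarify
        fix t assume "t \<in> {-\<epsilon><..<\<epsilon>}"
        then have "c t \<in> \<phi> ` (M \<inter> U)"
          using cV c(3) unfolding L(2) by blast
        then obtain y where "y \<in> M" "y \<in> U" "c t = \<phi> y"
          by blast
        then show "\<psi> (c t) \<in> M"
          by (simp add: homD)
      qed
      show "\<psi> (c 0) = p"
        by (simp add: c_def \<psi>p)
      show "((\<lambda>t. \<psi> (c t)) has_vector_derivative w) (at 0)"
        using deriv[of 0] \<epsilon>(1) by (simp add: l(2) c_def)
    qed
  qed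
qed

text \<open>A slice chart and its inverse, each corrected by the derivative of the other, give maps
  with identity derivative between \<open>M\<close> and its tangent space. These supply both
  approximation hypotheses of the differentiability criterion.\<close>

lemma embedded_C2_submanifold_closest_point:
  fixes M :: "'a::euclidean_space set"
  assumes "embedded_C2_submanifold d M" "closed M" "p \<in> M"
  shows "subspace (tangent_space M p)"
    and "(closest_point M has_derivative orth_projector (tangent_space M p)) (at p)"
proof -
  obtain U V \<phi> \<psi> and L :: "'a set" where chart: "open U" "p \<in> U" "open V" "homeomorphism U V \<phi> \<psi>"
      "C2_on \<phi> U" "C2_on \<psi> V" "subspace L" "\<phi> ` (M \<inter> U) = L \<inter> V"
    using assms unfolding embedded_C2_submanifold_def by meson
  obtain \<phi>' :: "'a \<Rightarrow> 'a \<Rightarrow>\<^sub>L 'a" where "\<And>x. x \<in> U \<Longrightarrow> (\<phi> has_derivative blinfun_apply (\<phi>' x)) (at x)"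
    using chart(5) unfolding C2_on_def by meson
  then have \<phi>: "(\<phi> has_derivative blinfun_apply (\<phi>' p)) (at p)"
    using chart by blast
  obtain \<psi>' :: "'a \<Rightarrow> 'a \<Rightarrow>\<^sub>L 'a" and \<psi>''
    where \<psi>: "\<And>x. x \<in> V \<Longrightarrow> (\<psi> has_derivative blinfun_apply (\<psi>' x)) (at x)"
      and \<psi>'': "\<And>x. x \<in> V \<Longrightarrow> (\<psi>' has_derivative blinfun_apply (\<psi>'' x)) (at x)"
    using chart(6) unfolding C2_on_def by meson
  \<comment> \<open>The second derivative enters here: differentiability of \<open>\<psi>'\<close>
    makes it continuous, as needed for the tangent curves to be C1.\<close>
  have "continuous_on V \<psi>'"
    using \<psi>'' by (meson continuous_at_imp_continuous_on has_derivative_continuous)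
  note T = tangent_space_slice_chart[where \<psi>' = \<psi>', OF chart(1-4) \<phi> \<psi> this assms(3) chart(7,8)]
  define T where "T = tangent_space M p"
  have T_eq: "T = \<psi>' (\<phi> p) ` L"
    unfolding T_def by (rule T(1))
  have lin: "linear (\<psi>' (\<phi> p))"
    by (simp add: blinfun.bounded_linear_right bounded_linear.linear)
  show sub: "subspace (tangent_space M p)"
    using linear_subspace_image[OF lin chart(7)] by (simp add: T(1))
  have q: "\<phi> p \<in> L" "\<phi> p \<in> V"
    using chart(2,8) assms(3) by blast+
  have \<psi>p: "\<psi> (\<phi> p) = p"
    by (rule homeomorphism_apply1[OF chart(4,2)])
  show "(closest_point M has_derivative orth_projector (tangent_space M p)) (at p)"
  proof (rule closest_point_has_derivative_orth_projector[OF assms(2,3) sub], fold T_def)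
    fix e :: real
    assume e: "e > 0"
    \<comment> \<open>On \<open>M\<close> near \<open>p\<close> this map takes values in
      \<open>T\<close>, and its derivative is the identity, so its value at \<open>y\<close> serves
      as the \<open>s\<close> approximating \<open>y - p\<close>.\<close>
    have "((\<lambda>y. \<psi>' (\<phi> p) (\<phi> y - \<phi> p)) has_derivative (\<lambda>h. h)) (at p)"
      by (rule derivative_eq_intros \<phi> refl)+ (simp add: T(3))
    then obtain d1 where d1: "d1 > 0"
      "\<And>y. norm (y - p) < d1 \<Longrightarrow> norm (\<psi>' (\<phi> p) (\<phi> y - \<phi> p) - (y - p)) \<le> e * norm (y - p)"
      using e unfolding has_derivative_within_alt by (auto simp: blinfun.zero_right)
    obtain d2 where d2: "d2 > 0" "ball p d2 \<subseteq> U"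
      using chart(1,2) open_contains_ball by metis
    show "\<exists>d>0. \<forall>y\<in>M. norm (y - p) < d \<longrightarrow> (\<exists>s\<in>T. norm (y - p - s) \<le> e * norm (y - p))"
    proof (intro exI[of _ "min d1 d2"] conjI ballI impI)
      fix y assume y: "y \<in> M" "norm (y - p) < min d1 d2"
      then have "y \<in> U"
        using d2(2) by (auto simp: dist_norm norm_minus_commute)
      then have "\<phi> y \<in> L"
        using y(1) chart(8) by blast
      then have "\<psi>' (\<phi> p) (\<phi> y - \<phi> p) \<in> T"
        using q(1) chart(7) by (simp add: T_eq subspace_diff)
      then show "\<exists>s\<in>T. norm (y - p - s) \<le> e * norm (y - p)"
        using d1(2)[of y] y(2) by (metis min_less_iff_conj norm_minus_commute)
    qed (use d1 d2 in simp)
  next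
    fix e :: real
    assume e: "e > 0"
    \<comment> \<open>For small \<open>t\<close> in \<open>T\<close> this point lies in
      \<open>L \<inter> V\<close>, so \<open>\<psi>\<close> sends it into \<open>M\<close>. The
      composite has identity derivative at \<open>0\<close> and yields the point of \<open>M\<close>
      near \<open>p + t\<close>.\<close>
    have "((\<lambda>t. \<phi> p + \<phi>' p t) has_derivative \<phi>' p) (at 0)"
      by (rule derivative_eq_intros refl)+ simp
    from has_derivative_compose[OF this, of \<psi> "\<psi>' (\<phi> p)"]
    have "((\<lambda>t. \<psi> (\<phi> p + \<phi>' p t)) has_derivative (\<lambda>t. t)) (at 0)"
      using \<psi>[OF q(2)] by (simp add: T(3) blinfun.zero_right)
    then obtain d1 where d1: "d1 > 0"
      "\<And>t. norm t < d1 \<Longrightarrow> norm (\<psi> (\<phi> p + \<phi>' p t) - p - t) \<le> e * norm t"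
      using e unfolding has_derivative_within_alt by (auto simp: blinfun.zero_right \<psi>p)
    have "open ((\<lambda>t. \<phi> p + \<phi>' p t) -` V)"
      by (intro open_vimage chart continuous_intros)
    moreover have "0 \<in> (\<lambda>t. \<phi> p + \<phi>' p t) -` V"
      using q by (simp add: blinfun.zero_right)
    ultimately obtain d2 where d2: "d2 > 0" "ball 0 d2 \<subseteq> (\<lambda>t. \<phi> p + \<phi>' p t) -` V"
      using open_contains_ball by metis
    show "\<exists>d>0. \<forall>t\<in>T. norm t < d \<longrightarrow> (\<exists>y\<in>M. norm (y - p - t) \<le> e * norm t)"
    proof (intro exI[of _ "min d1 d2"] conjI ballI impI)
      fix t assume t: "t \<in> T" "norm t < min d1 d2"
      then have "\<phi> p + \<phi>' p t \<in> V"
        using d2(2) by auto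
      moreover have "\<phi>' p t \<in> L"
        using t(1) by (auto simp: T_eq T(2))
      then have "\<phi> p + \<phi>' p t \<in> L"
        using q(1) chart(7) by (simp add: subspace_add)
      ultimately have "\<phi> p + \<phi>' p t \<in> \<phi> ` (M \<inter> U)"
        unfolding chart(8) by blast
      then obtain y where "y \<in> M" "y \<in> U" "\<phi> p + \<phi>' p t = \<phi> y"
        by blast
      then have "\<psi> (\<phi> p + \<phi>' p t) \<in> M"
        by (simp add: homeomorphism_apply1[OF chart(4)])
      then show "\<exists>y\<in>M. norm (y - p - t) \<le> e * norm t"
        using d1(2)[of t] t(2) by auto
    qed (use d1 d2 in simp)
  qed
qed

section \<open>Projectors on principal-angle planes\<close>

lemma dim_1_obtain_unit:
  fixes S :: "'a::euclidean_space set"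
  assumes "subspace S" "dim S = 1"
  obtains u where "norm u = 1" "S = span {u}"
proof -
  obtain B where B: "B \<subseteq> S" "pairwise orthogonal B" "\<And>x. x \<in> B \<Longrightarrow> norm x = 1"
      "independent B" "card B = dim S" "span B = S"
    using orthonormal_basis_subspace[OF assms(1)] by metis
  then obtain u where "B = {u}"
    using assms(2) card_1_singletonE by metis
  with B that show ?thesis
    by auto
qed

text \<open>The projection lies in both \<open>W\<close> and \<open>S\<close>, hence on the line
  spanned by \<open>u\<close>; orthogonality of the residual to \<open>u\<close> fixes the
  coefficient. Invariance of the plane thus reduces each projector to a rank-one formula.\<close>

lemma orth_projector_span_unit:
  assumes "subspace S" "orth_projector S w \<in> W" "W \<inter> S = span {u}" "norm u = 1"
  shows "orth_projector S w = (w \<bullet> u) *\<^sub>R u"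
proof -
  have u: "u \<in> S"
    using assms(3) span_base[of u "{u}"] by auto
  have "orth_projector S w \<in> span {u}"
    using assms orth_projector_mem by blast
  then obtain c where c: "orth_projector S w = c *\<^sub>R u"
    by (auto simp: span_singleton)
  then have "(w - c *\<^sub>R u) \<bullet> u = 0"
    using orth_projector_orthogonal[OF assms(1) u, of w] by simp
  then have "c = w \<bullet> u"
    using assms(4) by (simp add: inner_diff_left norm_eq_1)
  with c show ?thesis
    by simp
qed

text \<open>Take \<open>u\<close> along the line in \<open>S\<close> and \<open>v\<close> orthogonal
  to it in \<open>W\<close>, with signs such that the line in \<open>T\<close> is spanned by
  \<open>cos \<theta> *\<^sub>R u + sin \<theta> *\<^sub>R v\<close>.\<close>

lemma principal_angle_plane_basis:
  fixes S T W :: "'a::euclidean_space set"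
  assumes S: "subspace S" and T: "subspace T" and W: "principal_angle_plane S T W \<theta>"
  obtains u v where "norm u = 1" "norm v = 1" "u \<bullet> v = 0" "span {u, v} = W"
    "orth_projector S u = u" "orth_projector S v = 0"
    "orth_projector T u = (cos \<theta>)\<^sup>2 *\<^sub>R u + (cos \<theta> * sin \<theta>) *\<^sub>R v"
    "orth_projector T v = (cos \<theta> * sin \<theta>) *\<^sub>R u + (sin \<theta>)\<^sup>2 *\<^sub>R v"
proof -
  note W = W[unfolded principal_angle_plane_def is_line_angle_def]
  obtain u where u: "norm u = 1" "W \<inter> S = span {u}"
    using dim_1_obtain_unit[of "W \<inter> S"] W S subspace_inter by metis
  obtain b0 where b0: "norm b0 = 1" "W \<inter> T = span {b0}"
    using dim_1_obtain_unit[of "W \<inter> T"] W T subspace_inter by metis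
  have \<theta>: "0 \<le> cos \<theta>" "0 \<le> sin \<theta>"
    using W by (auto intro!: cos_ge_zero sin_ge_zero)
  have uW: "u \<in> W" "u \<in> S" and b0W: "b0 \<in> W" "b0 \<in> T"
    using u b0 by (auto dest: equalityD2 simp: span_base)
  \<comment> \<open>The angle between lines determines only the absolute value of the inner product;
    flipping the sign of the generator makes it equal to \<open>cos \<theta>\<close>.\<close>
  define b where "b = (if u \<bullet> b0 \<ge> 0 then b0 else - b0)"
  have span_minus: "span {- x} = span {x}" for x :: 'a
    using span_neg[OF span_base[of "- x" "{- x}"]] by (auto simp: span_eq span_base span_neg)
  have b: "norm b = 1" "W \<inter> T = span {b}" "b \<in> W"
    using b0 b0W W span_minus[of b0] by (auto simp: b_def subspace_neg)
  have "\<bar>u \<bullet> b0\<bar> = cos \<theta>"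
    using W uW b0W u(1) b0(1) by auto
  then have ub: "u \<bullet> b = cos \<theta>"
    using \<theta> by (auto simp: b_def)
  have "dim {u} < dim W"
    using W dim_singleton[of u] u(1) by auto
  obtain v0 where v0: "norm v0 = 1" "v0 \<in> W" "u \<bullet> v0 = 0"
  proof -
    have "subspace W"
      using W by blast
    have "span {u} \<subset> span W"
      using \<open>dim {u} < dim W\<close> uW dim_subset by (metis dim_span empty_subsetI insert_subset less_irrefl psubsetI span_mono)
    then obtain x where x: "x \<noteq> 0" "x \<in> span W" "\<And>y. y \<in> span {u} \<Longrightarrow> orthogonal x y"
      using orthogonal_to_subspace_exists_gen by metis
    then have "x \<in> W" "u \<bullet> x = 0"
      using \<open>subspace W\<close> span_base[of u "{u}"]
      by (auto simp: span_eq_iff[THEN iffD2] orthogonal_def inner_commute)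
    with x(1) that[of "x /\<^sub>R norm x"] \<open>subspace W\<close> show thesis
      by (simp add: subspace_scale)
  qed
  \<comment> \<open>The sign is chosen so that \<open>v \<bullet> b\<close>, whose square will be
    \<open>(sin \<theta>)\<^sup>2\<close>, equals \<open>sin \<theta>\<close> itself.\<close>
  define v where "v = (if v0 \<bullet> b \<ge> 0 then v0 else - v0)"
  have v: "norm v = 1" "v \<in> W" "u \<bullet> v = 0" "v \<bullet> b \<ge> 0"
    using v0 W by (auto simp: v_def subspace_neg)
  have uv: "u \<bullet> u = 1" "v \<bullet> v = 1" "v \<bullet> u = 0" "u \<bullet> v = 0" "u \<noteq> v" "u \<noteq> 0" "v \<noteq> 0"
    using u v by (auto simp: norm_eq_1 inner_commute)
  have "independent {u, v}"
    using uv by (intro pairwise_orthogonal_independent) (auto simp: pairwise_insert orthogonal_def)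
  then have span: "span {u, v} = W"
    using W uW v uv(5) by (metis card_2_iff dim_eq_card_independent dim_eq_span empty_subsetI
        insert_subset order_refl span_eq_iff)
  obtain c d where "b = c *\<^sub>R u + d *\<^sub>R v"
    using b(3) span by (auto simp: span_insert span_singleton algebra_simps)
  moreover from this have "c = u \<bullet> b" "d = v \<bullet> b"
    by (simp_all add: inner_add_right uv)
  ultimately have b_eq: "b = cos \<theta> *\<^sub>R u + (v \<bullet> b) *\<^sub>R v"
    by (simp add: ub)
  have "1 = b \<bullet> b"
    using b(1) by (simp add: norm_eq_1)
  also have "\<dots> = (cos \<theta>)\<^sup>2 + (v \<bullet> b)\<^sup>2"
    by (subst (2) b_eq) (simp add: inner_add_right inner_commute[of b] ub power2_eq_square)
  finally have "(v \<bullet> b)\<^sup>2 = (sin \<theta>)\<^sup>2"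
    using sin_cos_squared_add[of \<theta>] by linarith
  then have vb: "v \<bullet> b = sin \<theta>"
    using v(4) \<theta>(2) by (simp add: power2_eq_iff_nonneg)
  have PT: "orth_projector T w = (w \<bullet> b) *\<^sub>R (cos \<theta> *\<^sub>R u + sin \<theta> *\<^sub>R v)" if "w \<in> W" for w
    using orth_projector_span_unit[OF T _ b(2,1)] W that b_eq vb by auto
  have PS: "orth_projector S w = (w \<bullet> u) *\<^sub>R u" if "w \<in> W" for w
    using orth_projector_span_unit[OF S _ u(2,1)] W that by auto
  show thesis
  proof (rule that[OF u(1) v(1,3) span])
    show "orth_projector S u = u" "orth_projector S v = 0"
      using PS uW v uv by simp_all
    show "orth_projector T u = (cos \<theta>)\<^sup>2 *\<^sub>R u + (cos \<theta> * sin \<theta>) *\<^sub>R v"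
      "orth_projector T v = (cos \<theta> * sin \<theta>) *\<^sub>R u + (sin \<theta>)\<^sup>2 *\<^sub>R v"
      using PT uW v by (simp_all add: ub vb scaleR_add_right power2_eq_square mult.commute)
  qed
qed

section \<open>Spectrum and symmetric part of the block\<close>

text \<open>With \<open>a\<close> and \<open>k\<close> as below, the block is \<open>-a\<close>
  times the identity plus \<open>k\<close> times the quarter-turn rotation, whose eigenvalues are
  \<open>\<i>\<close> and \<open>-\<i>\<close>.\<close>

lemma eigenvalues_rrr_block:
  "eigenvalues (rrr_block \<theta>) =
    {complex_of_real (- (sin \<theta>)\<^sup>2) + \<i> * complex_of_real (sin \<theta> * cos \<theta>),
     complex_of_real (- (sin \<theta>)\<^sup>2) - \<i> * complex_of_real (sin \<theta> * cos \<theta>)}"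
proof -
  define a k where "a = complex_of_real ((sin \<theta>)\<^sup>2)" and "k = complex_of_real (sin \<theta> * cos \<theta>)"
  have eq: "complex_matrix (rrr_block \<theta>) *v w = z *s w \<longleftrightarrow>
      (z + a) * w $ 1 = - (k * w $ 2) \<and> (z + a) * w $ 2 = k * w $ 1" for w z
  proof -
    have product: "complex_matrix (rrr_block \<theta>) *v w = vector [- a * w $ 1 - k * w $ 2, k * w $ 1 - a * w $ 2]"
      by (simp add: vec_eq_iff forall_2 complex_matrix_def rrr_block_def matrix_vector_mult_def sum_2
          a_def k_def)
    \<comment> \<open>Moving the terms across reverses the sign, so the two equations are compared
      through opposite differences.\<close>
    have iff: "x = y \<longleftrightarrow> x' = y'" if "x - y = y' - x'" for x y x' y' :: complex
      using that by (metis eq_iff_diff_eq_0)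
    have "- a * w $ 1 - k * w $ 2 = z * w $ 1 \<longleftrightarrow> (z + a) * w $ 1 = - (k * w $ 2)"
      "k * w $ 1 - a * w $ 2 = z * w $ 2 \<longleftrightarrow> (z + a) * w $ 2 = k * w $ 1"
      by (rule iff, simp add: algebra_simps)+
    then show ?thesis
      by (simp only: product vec_eq_iff forall_2 vector_2 vector_smult_component)
  qed
  have "z \<in> eigenvalues (rrr_block \<theta>) \<longleftrightarrow> z = - a + \<i> * k \<or> z = - a - \<i> * k" for z
  proof
    assume "z \<in> eigenvalues (rrr_block \<theta>)"
    then obtain w :: "complex^2" where w: "w \<noteq> 0" "(z + a) * w $ 1 = - (k * w $ 2)" "(z + a) * w $ 2 = k * w $ 1"
      unfolding eigenvalues_def mem_Collect_eq eq by blast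
    \<comment> \<open>Substituting each equation into the other makes the characteristic polynomial
      annihilate both coordinates, at least one of which is nonzero.\<close>
    have "((z + a)\<^sup>2 + k\<^sup>2) * w $ 1 = 0" "((z + a)\<^sup>2 + k\<^sup>2) * w $ 2 = 0"
      using w(2,3) by algebra+
    then have "(z + a)\<^sup>2 + k\<^sup>2 = 0"
      using w(1) by (auto simp: vec_eq_iff forall_2)
    moreover have "(z + a - \<i> * k) * (z + a + \<i> * k) = (z + a)\<^sup>2 + k\<^sup>2"
      by (simp add: algebra_simps power2_eq_square)
    ultimately have "z + a - \<i> * k = 0 \<or> z + a + \<i> * k = 0"
      by (metis mult_eq_0_iff)
    then show "z = - a + \<i> * k \<or> z = - a - \<i> * k"
      by (auto simp: algebra_simps add_eq_0_iff)
  next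
    \<comment> \<open>The eigenvectors used are \<open>vector [1, - \<i>]\<close> and
      \<open>vector [1, \<i>]\<close>; they also work when \<open>k = 0\<close>, where both
      eigenvalues coincide.\<close>
    have neq: "vector [1, x] \<noteq> (0 :: complex^2)" for x
      by (auto simp: vec_eq_iff forall_2)
    assume "z = - a + \<i> * k \<or> z = - a - \<i> * k"
    then show "z \<in> eigenvalues (rrr_block \<theta>)"
    proof
      assume "z = - a + \<i> * k"
      then have "z + a = k * \<i>"
        by simp
      then show ?thesis
        unfolding eigenvalues_def mem_Collect_eq eq
        by (intro exI[of _ "vector [1, - \<i>]"] conjI neq) (simp_all add: mult.assoc)
    next
      assume "z = - a - \<i> * k"
      then have "z + a = - (k * \<i>)"
        by simp
      then show ?thesis
        unfolding eigenvalues_def mem_Collect_eq eq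
        by (intro exI[of _ "vector [1, \<i>]"] conjI neq) (simp_all add: mult.assoc)
    qed
  qed
  then show ?thesis
    by (auto simp: a_def k_def)
qed

lemma symmetric_part_rrr_block:
  "symmetric_part (rrr_block \<theta>) = mat (- (sin \<theta>)\<^sup>2)"
  by (simp add: vec_eq_iff forall_2 symmetric_part_def rrr_block_def mat_def transpose_def)

section \<open>Jacobian of the flow field and its blocks\<close>

theorem lemma2p1:
  fixes A B :: "(real^'m) set" and xs :: "real^'m" and dA dB :: nat
    and TA TB :: "(real^'m) set" and pA pB Dv :: "real^'m \<Rightarrow> real^'m"
  assumes "closed A" and "closed B"
    and "embedded_C2_submanifold dA A" and "embedded_C2_submanifold dB B"
    and "xs \<in> A \<inter> B" and "transversal_at A B xs"
    and "TA = tangent_space A xs" and "TB = tangent_space B xs"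
    and "pA = orth_projector TA" and "pB = orth_projector TB"
    and "Dv = frechet_derivative (rrr_field A B) (at xs)"
  shows
    "rrr_field A B xs = 0 \<and>
     closest_point A differentiable (at xs) \<and>
     closest_point B differentiable (at xs) \<and>
     reflector A differentiable (at xs) \<and>
     rrr_field A B differentiable (at xs) \<and>
     Dv = (\<lambda>h. frechet_derivative (closest_point B) (at xs)
                  (frechet_derivative (reflector A) (at xs) h)
                - frechet_derivative (closest_point A) (at xs) h) \<and>
     Dv = (\<lambda>h. 2 *\<^sub>R pB (pA h) - pB h - pA h) \<and>
     (\<forall>h \<in> TA \<inter> TB. Dv h = 0) \<and>
     (\<forall>W \<theta>. principal_angle_plane TA TB W \<theta> \<longrightarrow>
        (\<exists>e :: 2 \<Rightarrow> real^'m. orthonormal_basis_of e W \<and>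
           has_matrix_in pA e (vector [vector [1, 0], vector [0, 0]]) \<and>
           has_matrix_in pB e
             (vector [vector [(cos \<theta>)\<^sup>2, cos \<theta> * sin \<theta>],
                      vector [cos \<theta> * sin \<theta>, (sin \<theta>)\<^sup>2]]) \<and>
           has_matrix_in Dv e (rrr_block \<theta>))) \<and>
     (\<forall>\<theta> \<in> {0<..pi / 2}.
        eigenvalues (rrr_block \<theta>) =
          {complex_of_real (- (sin \<theta>)\<^sup>2) + \<i> * complex_of_real (sin \<theta> * cos \<theta>),
           complex_of_real (- (sin \<theta>)\<^sup>2) - \<i> * complex_of_real (sin \<theta> * cos \<theta>)} \<and>
        symmetric_part (rrr_block \<theta>) = mat (- (sin \<theta>)\<^sup>2))"
proof -
  have TA: "subspace TA" and PA: "(closest_point A has_derivative pA) (at xs)"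
    using embedded_C2_submanifold_closest_point[OF assms(3,1)] assms by auto
  have TB: "subspace TB" and PB: "(closest_point B has_derivative pB) (at xs)"
    using embedded_C2_submanifold_closest_point[OF assms(4,2)] assms by auto
  have lin: "linear pA" "linear pB"
    using TA TB assms linear_orth_projector by auto
  have fix_xs: "closest_point A xs = xs" "closest_point B xs = xs" "reflector A xs = xs"
    using assms(5) by (auto simp: closest_point_self reflector_def algebra_simps scaleR_2)
  have RA: "(reflector A has_derivative (\<lambda>h. 2 *\<^sub>R pA h - h)) (at xs)"
    unfolding reflector_def[abs_def] by (intro derivative_intros PA)
  \<comment> \<open>The reflector fixes \<open>xs\<close>, so the outer derivative in the chain rule
    is again taken at \<open>xs\<close>, where it is \<open>pB\<close>.\<close>
  have "((\<lambda>x. closest_point B (reflector A x)) has_derivative (\<lambda>h. pB (2 *\<^sub>R pA h - h))) (at xs)"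
    by (rule has_derivative_compose[OF RA]) (simp add: fix_xs PB)
  then have v: "(rrr_field A B has_derivative (\<lambda>h. pB (2 *\<^sub>R pA h - h) - pA h)) (at xs)"
    unfolding rrr_field_def[abs_def] by (intro derivative_intros PA)
  have Dv: "Dv = (\<lambda>h. pB (2 *\<^sub>R pA h - h) - pA h)"
    using frechet_derivative_at[OF v] assms by simp
  then have chain: "Dv = (\<lambda>h. frechet_derivative (closest_point B) (at xs)
                  (frechet_derivative (reflector A) (at xs) h)
                - frechet_derivative (closest_point A) (at xs) h)"
    by (simp add: frechet_derivative_at[OF PA, symmetric] frechet_derivative_at[OF PB, symmetric]
        frechet_derivative_at[OF RA, symmetric])
  from Dv have Dv': "Dv = (\<lambda>h. 2 *\<^sub>R pB (pA h) - pB h - pA h)"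
    by (simp add: linear_diff[OF lin(2)] linear_scale[OF lin(2)])
  have "Dv h = 0" if "h \<in> TA \<inter> TB" for h
    using that TA TB by (simp add: Dv' assms(9,10) orth_projector_id scaleR_2)
  moreover have "\<exists>e :: 2 \<Rightarrow> real^'m. orthonormal_basis_of e W \<and>
           has_matrix_in pA e (vector [vector [1, 0], vector [0, 0]]) \<and>
           has_matrix_in pB e
             (vector [vector [(cos \<theta>)\<^sup>2, cos \<theta> * sin \<theta>],
                      vector [cos \<theta> * sin \<theta>, (sin \<theta>)\<^sup>2]]) \<and>
           has_matrix_in Dv e (rrr_block \<theta>)" if W: "principal_angle_plane TA TB W \<theta>" for W \<theta>
  proof -
    obtain x y where xy: "norm x = 1" "norm y = 1" "x \<bullet> y = 0" "span {x, y} = W"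
      "pA x = x" "pA y = 0"
      "pB x = (cos \<theta>)\<^sup>2 *\<^sub>R x + (cos \<theta> * sin \<theta>) *\<^sub>R y"
      "pB y = (cos \<theta> * sin \<theta>) *\<^sub>R x + (sin \<theta>)\<^sup>2 *\<^sub>R y"
      using principal_angle_plane_basis[OF TA TB W] assms(9,10) by metis
    \<comment> \<open>The index type has exactly the elements \<open>1\<close> and \<open>2\<close>,
      so the other index is \<open>2\<close>, in the order of the matrix columns.\<close>
    define e :: "2 \<Rightarrow> real^'m" where "e i = (if i = 1 then x else y)" for i
    have e: "e 1 = x" "e 2 = y" "range e = {x, y}"
      by (auto simp: e_def UNIV_2)
    \<comment> \<open>Since \<open>pA x = x\<close> and \<open>pA y = 0\<close>, the Jacobian
      reduces to \<open>pB x - x\<close> on \<open>x\<close> and to \<open>- pB y\<close> on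
      \<open>y\<close>; the first uses that \<open>(cos \<theta>)\<^sup>2 - 1\<close> is
      \<open>- (sin \<theta>)\<^sup>2\<close>.\<close>
    have "Dv x = (- (sin \<theta>)\<^sup>2) *\<^sub>R x + (sin \<theta> * cos \<theta>) *\<^sub>R y"
      "Dv y = (- (sin \<theta> * cos \<theta>)) *\<^sub>R x + (- (sin \<theta>)\<^sup>2) *\<^sub>R y"
      by (simp_all add: Dv' xy linear_0[OF lin(2)] cos_squared_eq algebra_simps scaleR_2)
    then have "has_matrix_in Dv e (rrr_block \<theta>)"
      by (simp add: has_matrix_in_def forall_2 sum_2 e rrr_block_def)
    moreover have "has_matrix_in pA e (vector [vector [1, 0], vector [0, 0]])"
      by (simp add: has_matrix_in_def forall_2 sum_2 e xy)
    moreover have "has_matrix_in pB e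
             (vector [vector [(cos \<theta>)\<^sup>2, cos \<theta> * sin \<theta>],
                      vector [cos \<theta> * sin \<theta>, (sin \<theta>)\<^sup>2]])"
      by (simp add: has_matrix_in_def forall_2 sum_2 e xy)
    moreover have "x \<bullet> x = 1" "y \<bullet> y = 1" "y \<bullet> x = 0"
      using xy by (simp_all add: norm_eq_1 inner_commute)
    then have "orthonormal_basis_of e W"
      using xy(3,4) by (simp add: orthonormal_basis_of_def forall_2 e)
    ultimately show ?thesis
      by blast
  qed
  moreover have "rrr_field A B xs = 0"
    by (simp add: rrr_field_def fix_xs)
  ultimately show ?thesis
    using PA PB RA v chain Dv' eigenvalues_rrr_block symmetric_part_rrr_block
    unfolding differentiable_def by blast
qed

end
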